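(* Let $G$ be a compactly generated locally compact abelian group and let $\mathcal{L}$ be a Delone set in $G$ with finite local complexity. Then the following assertions are equivalent: (i) $\mathcal{L}$ is completely periodic. (ii) The measure $\delta_{\mathcal{L}}=\sum_{x\in\mathcal{L}}\delta_x$ is strongly almost periodic.
   Context: Groups are Hausdorff and written additively, with neutral element $e$. A locally compact abelian group $G$ is compactly generated if there is a compact neighborhood $W$ of $e$ such that the smallest subgroup of $G$ containing $W$ is $G$. A subset $A\subset G$ is relatively dense if there is a compact $K\subset G$ with $A+K=G$. A subset $\mathcal{L}\subset G$ is uniformly discrete if there is an open neighborhood $U$ of $e$ with $(x+U)\cap(y+U)=\emptyset$ for all $x\neq y$ in $\mathcal{L}$; it is a Delone set if it is uniformly discrete and relatively dense. $\mathcal{L}$ has finite local complexity if for every compact $K\subset G$ the set $\{(-x+\mathcal{L})\cap K : x\in\mathcal{L}\}$ is finite. The periods of $\mathcal{L}$ are the $t\in G$ with $t+\mathcal{L}=\mathcal{L}$; $\mathcal{L}$ is completely periodic (crystalline) if its set of periods is relatively dense in $G$. Here $\delta_x$ is the unit point mass at $x$. A (complex regular Borel) measure $\nu$ on $G$ is translation bounded if for some (equivalently every) nonempty open relatively compact $V\subset G$ there is $C\ge 0$ with $|\nu|(t+V)\le C$ for all $t\in G$; $\delta_{\mathcal{L}}$ is translation bounded for uniformly discrete $\mathcal{L}$. For $\varphi\in C_c(G)$ (continuous, compactly supported), $(\nu*\varphi)(s)=\int_G\varphi(s-u)\,d\nu(u)$, which is a bounded continuous function if $\nu$ is translation bounded.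 A bounded continuous function $f$ on $G$ is (Bohr) almost periodic if for every $\epsilon>0$ the set of $t\in G$ with $\sup_{s\in G}|f(s-t)-f(s)|\le\epsilon$ is relatively dense in $G$. A translation bounded measure $\nu$ is strongly almost periodic if $\nu*\varphi$ is Bohr almost periodic for every $\varphi\in C_c(G)$. *)

theory Defs
  imports
    "HOL-Probability.Probability"
    "HOL-Computational_Algebra.Group_Closure"
begin

text \<open>
  The ambient group \<open>G\<close> is a type \<open>'a :: {topological_ab_group_add, t2_space}\<close>, i.e. an
  additive Hausdorff topological abelian group; its neutral element is \<open>0\<close>, and \<open>t + A\<close> is
  rendered as the image \<open>(+) t ` A\<close>.
\<close>

definition compactly_generated :: "'a::{topological_ab_group_add, t2_space} itself \<Rightarrow> bool" where
  "compactly_generated _ \<longleftrightarrow>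
     (\<exists>W::'a set. compact W \<and> 0 \<in> interior W \<and> group_closure W = UNIV)"

definition relatively_dense :: "'a::{topological_ab_group_add, t2_space} set \<Rightarrow> bool" where
  "relatively_dense A \<longleftrightarrow> (\<exists>K. compact K \<and> {a + k | a k. a \<in> A \<and> k \<in> K} = UNIV)"

definition uniformly_discrete :: "'a::{topological_ab_group_add, t2_space} set \<Rightarrow> bool" where
  "uniformly_discrete L \<longleftrightarrow>
     (\<exists>U. open U \<and> 0 \<in> U \<and> (\<forall>x\<in>L. \<forall>y\<in>L. x \<noteq> y \<longrightarrow> (+) x ` U \<inter> (+) y ` U = {}))"

definition Delone :: "'a::{topological_ab_group_add, t2_space} set \<Rightarrow> bool" where
  "Delone L \<longleftrightarrow> uniformly_discrete L \<and> relatively_dense L"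

definition finite_local_complexity ::
  "'a::{topological_ab_group_add, t2_space} set \<Rightarrow> bool" where
  "finite_local_complexity L \<longleftrightarrow>
     (\<forall>K. compact K \<longrightarrow> finite {(+) (- x) ` L \<inter> K | x. x \<in> L})"

definition periods :: "'a::{topological_ab_group_add, t2_space} set \<Rightarrow> 'a set" where
  "periods L = {t. (+) t ` L = L}"

definition completely_periodic :: "'a::{topological_ab_group_add, t2_space} set \<Rightarrow> bool" where
  "completely_periodic L \<longleftrightarrow> relatively_dense (periods L)"

text \<open>
  Measures are the nonnegative ones, so that \<open>\<bar>\<nu>\<bar> = \<nu>\<close>. Regularity is the usual notion for
  locally compact spaces: finiteness on compact sets, outer regularity on Borel sets, and inner
  regularity on open sets.
\<close>

definition regular_borel_measure :: "'a::{topological_ab_group_add, t2_space} measure \<Rightarrow> bool" where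
  "regular_borel_measure \<nu> \<longleftrightarrow>
     sets \<nu> = sets borel \<and>
     (\<forall>K. compact K \<longrightarrow> emeasure \<nu> K < \<infinity>) \<and>
     (\<forall>A\<in>sets borel. emeasure \<nu> A = (INF U\<in>{U. open U \<and> A \<subseteq> U}. emeasure \<nu> U)) \<and>
     (\<forall>U. open U \<longrightarrow> emeasure \<nu> U = (SUP K\<in>{K. compact K \<and> K \<subseteq> U}. emeasure \<nu> K))"

definition translation_bounded :: "'a::{topological_ab_group_add, t2_space} measure \<Rightarrow> bool" where
  "translation_bounded \<nu> \<longleftrightarrow> regular_borel_measure \<nu> \<and>
     (\<exists>V. open V \<and> V \<noteq> {} \<and> compact (closure V) \<and>
        (\<exists>C\<ge>0. \<forall>t. emeasure \<nu> ((+) t ` V) \<le> ennreal C))"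

definition C_c :: "('a::{topological_ab_group_add, t2_space} \<Rightarrow> complex) set" where
  "C_c = {\<phi>. continuous_on UNIV \<phi> \<and> compact (closure {x. \<phi> x \<noteq> 0})}"

definition measure_convolution ::
  "'a::{topological_ab_group_add, t2_space} measure \<Rightarrow> ('a \<Rightarrow> complex) \<Rightarrow> 'a \<Rightarrow> complex" where
  "measure_convolution \<nu> \<phi> s = (\<integral>u. \<phi> (s - u) \<partial>\<nu>)"

text \<open>Boundedness of \<open>f\<close> ensures that the real-valued supremum is a genuine one.\<close>

definition Bohr_almost_periodic ::
  "('a::{topological_ab_group_add, t2_space} \<Rightarrow> complex) \<Rightarrow> bool" where
  "Bohr_almost_periodic f \<longleftrightarrow>
     continuous_on UNIV f \<and> bounded (range f) \<and>
     (\<forall>\<epsilon>>0. relatively_dense {t. (SUP s. cmod (f (s - t) - f s)) \<le> \<epsilon>})"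

definition strongly_almost_periodic ::
  "'a::{topological_ab_group_add, t2_space} measure \<Rightarrow> bool" where
  "strongly_almost_periodic \<nu> \<longleftrightarrow> translation_bounded \<nu> \<and>
     (\<forall>\<phi>\<in>C_c. Bohr_almost_periodic (measure_convolution \<nu> \<phi>))"

text \<open>The unit point mass at \<open>x\<close> is \<^term>\<open>return borel x\<close>.\<close>

definition dirac_comb :: "'a::{topological_ab_group_add, t2_space} set \<Rightarrow> 'a measure" where
  "dirac_comb L =
     measure_of UNIV (sets borel) (\<lambda>A. \<Sum>\<^sub>\<infinity>x\<in>L. emeasure (return borel x) A)"

lemma sets_dirac_comb [simp]: "sets (dirac_comb L) = sets borel"
  by (metis dirac_comb_def sets.sets_measure_of_eq space_borel)

lemma space_dirac_comb [simp]: "space (dirac_comb L) = UNIV"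
  by (simp add: dirac_comb_def space_measure_of_conv)

text \<open>
  \<^const>\<open>measure_of\<close> yields the zero measure unless the given set function is a measure; the
  next lemma rules this out.
\<close>

lemma emeasure_dirac_comb:
  assumes "A \<in> sets borel"
  shows "emeasure (dirac_comb L) A = (\<Sum>\<^sub>\<infinity>x\<in>L. emeasure (return borel x) A)"
proof (rule emeasure_measure_of[OF dirac_comb_def])
  let ?\<mu> = "\<lambda>A. \<Sum>\<^sub>\<infinity>x\<in>L. emeasure (return borel x) A"
  have SUP: "?\<mu> B = (SUP F\<in>{F. finite F \<and> F \<subseteq> L}. \<Sum>x\<in>F. emeasure (return borel x) B)" for B
    by (subst nonneg_infsum_complete) auto
  show "positive (sets (dirac_comb L)) ?\<mu>"
    by (simp add: positive_def)
  show "countably_additive (sets (dirac_comb L)) ?\<mu>"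
  proof (rule countably_additiveI)
    fix B :: "nat \<Rightarrow> 'a set"
    assume B: "range B \<subseteq> sets (dirac_comb L)" "disjoint_family B"
    have eq: "(\<Sum>i. emeasure (return borel x) (B i)) = emeasure (return borel x) (\<Union>i. B i)" for x
      using B by (intro suminf_emeasure) auto
    have "(\<Sum>i. ?\<mu> (B i)) =
        (SUP F\<in>{F. finite F \<and> F \<subseteq> L}. \<Sum>i. \<Sum>x\<in>F. emeasure (return borel x) (B i))"
      unfolding SUP
    proof (rule ennreal_suminf_SUP_eq_directed)
      fix N :: "nat set" and F F'
      assume "finite N" "F \<in> {F. finite F \<and> F \<subseteq> L}" "F' \<in> {F. finite F \<and> F \<subseteq> L}"
      then show "\<exists>k\<in>{F. finite F \<and> F \<subseteq> L}. \<forall>n\<in>N.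
          (\<Sum>x\<in>F. emeasure (return borel x) (B n)) \<le> (\<Sum>x\<in>k. emeasure (return borel x) (B n)) \<and>
          (\<Sum>x\<in>F'. emeasure (return borel x) (B n)) \<le> (\<Sum>x\<in>k. emeasure (return borel x) (B n))"
        by (intro bexI[of _ "F \<union> F'"]) (auto intro!: sum_mono2)
    qed
    also have "\<dots> = ?\<mu> (\<Union>i. B i)"
      unfolding SUP by (simp add: eq[symmetric] suminf_sum)
    finally show "(\<Sum>i. ?\<mu> (B i)) = ?\<mu> (\<Union>i. B i)" .
  qed
qed (use assms sets.sets_into_space in auto)

end

theory Submission
  imports Defs
begin

text \<open>
  Convolving with the Dirac comb of \<open>L\<close> gives \<open>f s = (\<Sum>x\<in>L. \<phi> (s - x))\<close>, locally a finite sum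
  because \<open>L\<close> meets each compact set in a finite set. Every period of \<open>L\<close> is a period of \<open>f\<close>, so
  a relatively dense set of periods of \<open>L\<close> makes \<open>f\<close> almost periodic.

  For the converse, take a bump \<open>\<phi> \<ge> 0\<close> with \<open>\<phi> 0 = 1\<close> that vanishes outside a small symmetric
  neighbourhood \<open>U\<close> of \<open>0\<close>. Then \<open>\<bar>f\<bar> \<ge> 1\<close> on \<open>L\<close>, while \<open>f s \<noteq> 0\<close> forces \<open>s \<in> L + U\<close>. Hence for a
  \<open>1/2\<close>-almost period \<open>t\<close> of \<open>f\<close> the sets \<open>L - t\<close> and \<open>L\<close> agree up to errors in \<open>U\<close>: each \<open>x \<in> L\<close>
  has a partner \<open>y x \<in> L\<close> with \<open>u x = x - t - y x \<in> U\<close>. The point is that \<open>u\<close> is constant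
  (\<open>approximate_translate_near_period\<close>). Two ingredients give this.

  First, since \<open>G\<close> is generated by a compact set \<open>W\<close> and \<open>L + K = G\<close> with \<open>K\<close> compact, any two points
  of \<open>L\<close> are joined by a chain in \<open>L\<close> with steps, in one direction or the other, in the
  compact set \<open>D = (W \<union> {0}) + K - K\<close> (\<open>constant_on_chained\<close>).

  Second, if \<open>x' - x \<in> D\<close>, then \<open>x' - x\<close> and \<open>y x' - y x\<close> both are differences of points of \<open>L\<close>
  that lie in a fixed compact neighbourhood of \<open>D\<close>; finite local complexity leaves only finitely
  many of those, so for \<open>U\<close> small enough two of them that differ by an element of \<open>U - U\<close> are equal
  (\<open>rigid_nbhd_exists\<close>). This says \<open>u x = u x'\<close>.

  With \<open>u\<close> constant, \<open>t + u\<close> is a period of \<open>L\<close>. So all \<open>1/2\<close>-almost periods of \<open>f\<close> are within \<open>U\<close>,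
  hence within a fixed compact set, of a period, and the periods are relatively dense.
\<close>

section \<open>Topological groups\<close>

lemma compact_set_plus:
  fixes A B :: "'a::topological_group_add set"
  assumes "compact A" "compact B"
  shows "compact {a + b | a b. a \<in> A \<and> b \<in> B}"
proof -
  have "{a + b | a b. a \<in> A \<and> b \<in> B} = (\<lambda>p. fst p + snd p) ` (A \<times> B)"
    by force
  moreover have "compact \<dots>"
    by (intro compact_continuous_image compact_Times assms continuous_intros)
  ultimately show ?thesis by simp
qed

lemma compact_set_minus:
  fixes A B :: "'a::topological_group_add set"
  assumes "compact A" "compact B"
  shows "compact {a - b | a b. a \<in> A \<and> b \<in> B}"
proof -
  have "{a - b | a b. a \<in> A \<and> b \<in> B} = (\<lambda>p. fst p - snd p) ` (A \<times> B)"
    by force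
  moreover have "compact \<dots>"
    by (intro compact_continuous_image compact_Times assms continuous_intros)
  ultimately show ?thesis by simp
qed

lemma compact_translate:
  fixes A :: "'a::topological_group_add set"
  assumes "compact A"
  shows "compact ((+) t ` A)"
  by (intro compact_continuous_image assms continuous_intros)

lemma mem_translate_iff:
  fixes x t :: "'a::ab_group_add"
  shows "x \<in> (+) t ` A \<longleftrightarrow> x - t \<in> A"
  by (force simp: image_iff)

lemma open_minus_const_vimage:
  fixes U :: "'a::topological_group_add set"
  assumes "open U"
  shows "open {x. x - t \<in> U}"
proof -
  have "open ((\<lambda>x. x - t) -` U)"
    by (intro open_vimage assms continuous_intros)
  then show ?thesis by (simp add: vimage_def)
qed

lemma open_const_minus_vimage:
  fixes U :: "'a::topological_group_add set"
  assumes "open U"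
  shows "open {x. t - x \<in> U}"
proof -
  have "open ((\<lambda>x. t - x) -` U)"
    by (intro open_vimage assms continuous_intros)
  then show ?thesis by (simp add: vimage_def)
qed

lemma symmetric_nbhd_diff_in:
  fixes T V :: "'a::topological_group_add set"
  assumes "open T" "0 \<in> T" "open V" "0 \<in> V"
  obtains U where "open U" "0 \<in> U" "U \<subseteq> V" "\<forall>u\<in>U. - u \<in> U" "\<forall>u\<in>U. \<forall>v\<in>U. u - v \<in> T"
proof -
  have "open ((\<lambda>p::'a \<times> 'a. fst p - snd p) -` T)"
    by (intro open_vimage assms continuous_intros)
  moreover have "(0, 0) \<in> (\<lambda>p::'a \<times> 'a. fst p - snd p) -` T"
    using assms by simp
  ultimately obtain A B where AB: "open A" "open B" "(0, 0) \<in> A \<times> B"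
      "A \<times> B \<subseteq> (\<lambda>p::'a \<times> 'a. fst p - snd p) -` T"
    by (rule open_prod_elim)
  define O1 where "O1 = A \<inter> B \<inter> V"
  have "open O1" "0 \<in> O1" using AB assms by (auto simp: O1_def)
  show thesis
  proof (rule that[of "O1 \<inter> {x. 0 - x \<in> O1}"])
    show "open (O1 \<inter> {x. 0 - x \<in> O1})"
      by (intro open_Int open_const_minus_vimage \<open>open O1\<close>)
    show "\<forall>u\<in>O1 \<inter> {x. 0 - x \<in> O1}. \<forall>v\<in>O1 \<inter> {x. 0 - x \<in> O1}. u - v \<in> T"
    proof (intro ballI)
      fix u v assume "u \<in> O1 \<inter> {x. 0 - x \<in> O1}" "v \<in> O1 \<inter> {x. 0 - x \<in> O1}"
      then have "(u, v) \<in> A \<times> B" by (auto simp: O1_def)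
      then show "u - v \<in> T" using AB by auto
    qed
  qed (use \<open>0 \<in> O1\<close> in \<open>auto simp: O1_def\<close>)
qed

lemma locally_compact_zero_nbhd:
  assumes "locally_compact_space (euclidean :: 'a::{topological_ab_group_add, t2_space} topology)"
  obtains U K :: "'a::{topological_ab_group_add, t2_space} set" where "open U" "compact K" "0 \<in> U" "U \<subseteq> K"
  using assms unfolding locally_compact_space_def by (auto; metis)

text \<open>
  A locally compact Hausdorff space is completely regular, which gives the bump; its support is
  compact because \<open>K\<close> is closed and contains it.
\<close>

lemma locally_compact_bump:
  fixes U :: "'a::{topological_ab_group_add, t2_space} set"
  assumes lc: "locally_compact_space (euclidean :: 'a topology)"
    and U: "open U" "0 \<in> U" "U \<subseteq> K" "compact K"
  obtains \<phi> :: "'a \<Rightarrow> real" where "(\<lambda>x. complex_of_real (\<phi> x)) \<in> C_c" "\<phi> 0 = 1"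
    "\<forall>x. 0 \<le> \<phi> x" "\<forall>x. \<phi> x \<noteq> 0 \<longrightarrow> x \<in> U"
proof -
  have "Hausdorff_space (euclidean :: 'a topology)"
    unfolding Hausdorff_space_def disjnt_def open_openin[symmetric] by (blast intro: hausdorff)
  then have "completely_regular_space (euclidean :: 'a topology)"
    by (intro locally_compact_regular_imp_completely_regular_space[OF lc] disjI1)
  then have "\<forall>S x. openin (euclidean :: 'a topology) S \<longrightarrow> x \<in> S \<longrightarrow>
      (\<exists>f::'a \<Rightarrow> real. continuous_map euclidean euclidean f \<and> f x = 1 \<and>
        f ` (topspace euclidean - S) \<subseteq> {0})"
    by (subst (asm) completely_regular_space_gen_alt'[of "1::real" 0]) simp_all
  from this[rule_format, of U 0] U obtain f :: "'a \<Rightarrow> real"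
    where "continuous_map euclidean euclidean f" "f 0 = 1" "f ` (- U) \<subseteq> {0}"
    by (auto simp: Compl_eq_Diff_UNIV)
  then have f: "continuous_on UNIV f" "f 0 = 1" "\<And>x. x \<notin> U \<Longrightarrow> f x = 0"
    by (auto simp: image_subset_iff)
  have "closure {x. \<bar>f x\<bar> \<noteq> 0} \<subseteq> K"
    using f U by (intro closure_minimal) (auto intro: compact_imp_closed)
  then have "compact (closure {x. \<bar>f x\<bar> \<noteq> 0})"
    using U(4) closed_closure compact_Int_closed by (metis inf.absorb_iff2)
  then have "(\<lambda>x. complex_of_real \<bar>f x\<bar>) \<in> C_c"
    using f by (auto simp: C_c_def intro!: continuous_intros)
  then show thesis
    using f by (intro that[of "\<lambda>x. \<bar>f x\<bar>"]) auto
qed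

section \<open>Uniformly discrete sets\<close>

text \<open>
  If \<open>U\<close> witnesses uniform discreteness, then \<open>z - U\<close> holds at most one point of \<open>L\<close> for every \<open>z\<close>.
  The bound is the number of sets \<open>c - U\<close> in a finite cover of \<open>K\<close>, which is insensitive to
  translating \<open>K\<close>.
\<close>

lemma uniformly_discrete_card_translate_bound:
  fixes L :: "'a::{topological_ab_group_add, t2_space} set"
  assumes "uniformly_discrete L" "compact K"
  obtains N where "\<And>t. finite (L \<inter> (+) t ` K)" "\<And>t. card (L \<inter> (+) t ` K) \<le> N"
proof -
  obtain U where U: "open U" "0 \<in> U"
    and disj: "\<And>x y. x \<in> L \<Longrightarrow> y \<in> L \<Longrightarrow> x \<noteq> y \<Longrightarrow> (+) x ` U \<inter> (+) y ` U = {}"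
    using assms(1) unfolding uniformly_discrete_def by blast
  have uniq: "x = y" if "x \<in> L" "y \<in> L" "z - x \<in> U" "z - y \<in> U" for x y z
    using disj[OF that(1,2)] that(3,4) by (metis disjoint_iff mem_translate_iff)
  obtain C where C: "C \<subseteq> K" "finite C" "K \<subseteq> (\<Union>c\<in>C. {x. c - x \<in> U})"
  proof (rule compactE_image[OF assms(2)])
    show "open {x. c - x \<in> U}" if "c \<in> K" for c
      by (rule open_const_minus_vimage[OF U(1)])
    show "K \<subseteq> (\<Union>c\<in>K. {x. c - x \<in> U})" using U(2) by auto
  qed
  \<comment> \<open>Each of the finitely many sets \<open>t + c - U\<close> covering \<open>t + K\<close> holds at most one point.\<close>
  define g where "g t x = (SOME c. c \<in> C \<and> c - (x - t) \<in> U)" for t x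
  have g: "g t x \<in> C \<and> g t x - (x - t) \<in> U" if "x \<in> L \<inter> (+) t ` K" for t x
  proof -
    have "\<exists>c. c \<in> C \<and> c - (x - t) \<in> U" using that C(3) by (auto simp: mem_translate_iff)
    then show ?thesis unfolding g_def by (rule someI_ex)
  qed
  have inj: "inj_on (g t) (L \<inter> (+) t ` K)" for t
  proof (rule inj_onI)
    fix x y assume xy: "x \<in> L \<inter> (+) t ` K" "y \<in> L \<inter> (+) t ` K" "g t x = g t y"
    have "g t x + t - x \<in> U" "g t x + t - y \<in> U"
      using g[OF xy(1)] g[OF xy(2)] xy(3) by (simp_all add: algebra_simps)
    then show "x = y" using uniq xy(1,2) by blast
  qed
  have img: "g t ` (L \<inter> (+) t ` K) \<subseteq> C" for t using g by blast
  show thesis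
    using that[of "card C"] inj img C(2)
    by (meson card_inj_on_le inj_on_finite)
qed

lemma uniformly_discrete_finite_Int:
  fixes L :: "'a::{topological_ab_group_add, t2_space} set"
  assumes "uniformly_discrete L" "compact K"
  shows "finite (L \<inter> K)"
proof -
  obtain N where "\<And>t. finite (L \<inter> (+) t ` K)"
    using uniformly_discrete_card_translate_bound[OF assms] by metis
  from this[of 0] show ?thesis by simp
qed

text \<open>
  Every point has a neighbourhood that meets \<open>L\<close> at most once, so all subsets of \<open>L\<close> are closed.
  Outer regularity of the Dirac comb rests on this.
\<close>

lemma uniformly_discrete_subset_closed:
  fixes L :: "'a::{topological_ab_group_add, t2_space} set"
  assumes "uniformly_discrete L" "M \<subseteq> L"
  shows "closed M"
  unfolding closed_def
proof (subst open_subopen, rule ballI)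
  fix z assume z: "z \<in> - M"
  obtain U where U: "open U" "0 \<in> U"
    and disj: "\<And>x y. x \<in> L \<Longrightarrow> y \<in> L \<Longrightarrow> x \<noteq> y \<Longrightarrow> (+) x ` U \<inter> (+) y ` U = {}"
    using assms(1) unfolding uniformly_discrete_def by blast
  have uniq: "x = y" if "x \<in> L" "y \<in> L" "z - x \<in> U" "z - y \<in> U" for x y
    using disj[OF that(1,2)] that(3,4) by (metis disjoint_iff mem_translate_iff)
  \<comment> \<open>The neighbourhood \<open>z - U\<close> of \<open>z\<close> misses \<open>M\<close> once its at most one point of \<open>M\<close> is removed.\<close>
  define F where "F = M \<inter> {x. z - x \<in> U}"
  have "finite F"
  proof (cases "F = {}")
    case False
    then obtain a where "a \<in> F" by blast
    then have "F \<subseteq> {a}" using uniq assms(2) by (auto simp: F_def)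
    then show ?thesis using finite_subset by blast
  qed simp
  then have "open ({x. z - x \<in> U} - F)"
    by (intro open_Diff open_const_minus_vimage U finite_imp_closed)
  then show "\<exists>T. open T \<and> z \<in> T \<and> T \<subseteq> - M"
    using U z by (intro exI[of _ "{x. z - x \<in> U} - F"]) (auto simp: F_def)
qed

section \<open>The Dirac comb\<close>

lemma emeasure_dirac_comb_SUP:
  fixes L :: "'a::{topological_ab_group_add, t2_space} set"
  assumes "A \<in> sets borel"
  shows "emeasure (dirac_comb L) A = (SUP F\<in>{F. finite F \<and> F \<subseteq> L}. \<Sum>x\<in>F. indicator A x)"
  by (simp add: emeasure_dirac_comb assms nonneg_infsum_complete)

lemma emeasure_dirac_comb_cong:
  fixes L :: "'a::{topological_ab_group_add, t2_space} set"
  assumes "A \<in> sets borel" "B \<in> sets borel" "L \<inter> A = L \<inter> B"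
  shows "emeasure (dirac_comb L) A = emeasure (dirac_comb L) B"
  using assms by (auto simp: emeasure_dirac_comb indicator_def intro!: infsum_cong)

lemma emeasure_dirac_comb_finite:
  fixes L :: "'a::{topological_ab_group_add, t2_space} set"
  assumes "A \<in> sets borel" "finite (L \<inter> A)"
  shows "emeasure (dirac_comb L) A = of_nat (card (L \<inter> A))"
proof -
  have "emeasure (dirac_comb L) A = (\<Sum>\<^sub>\<infinity>x\<in>L \<inter> A. 1)"
    using assms(1) by (auto simp: emeasure_dirac_comb indicator_def intro!: infsum_cong_neutral)
  then show ?thesis using assms(2) by simp
qed

text \<open>
  The integrand agrees with its restriction to the finite set \<open>S\<close> up to a Borel set that contains
  no point of \<open>L\<close>, hence up to a null set; the restriction is a simple function. Leaving \<open>S\<close> free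
  makes it possible to use one index set for all \<open>s\<close> near a given point.
\<close>

lemma measure_convolution_dirac_comb:
  fixes L :: "'a::{topological_ab_group_add, t2_space} set"
  assumes \<phi>: "continuous_on UNIV \<phi>"
    and S: "finite S" "S \<subseteq> L" "\<And>x. x \<in> L \<Longrightarrow> \<phi> (s - x) \<noteq> 0 \<Longrightarrow> x \<in> S"
  shows "measure_convolution (dirac_comb L) \<phi> s = (\<Sum>x\<in>S. \<phi> (s - x))"
proof -
  define g where "g u = \<phi> (s - u)" for u
  have "continuous_on UNIV g"
    unfolding g_def by (intro continuous_on_compose2[OF \<phi>] continuous_intros) auto
  then have meas: "g \<in> borel_measurable borel"
    by (rule borel_measurable_continuous_onI)
  have [measurable]: "g \<in> borel_measurable (dirac_comb L)"
    using meas by (simp cong: measurable_cong_sets)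
  have Sb: "{x} \<in> sets borel" "S \<in> sets borel" for x :: 'a
    using S(1) by (auto intro!: borel_closed finite_imp_closed)
  have em: "emeasure (dirac_comb L) {x} = 1" if "x \<in> S" for x
    using that S(2) Sb by (subst emeasure_dirac_comb_finite) (auto simp: Int_absorb1)
  have "{u. g u \<noteq> 0} = g -` (UNIV - {0}) \<inter> space borel" by auto
  also have "\<dots> \<in> sets borel" by (intro measurable_sets[OF meas]) auto
  finally have bad: "{u. g u \<noteq> 0} - S \<in> sets borel" using Sb by blast
  moreover have "L \<inter> ({u. g u \<noteq> 0} - S) = {}" using S(3) by (auto simp: g_def)
  ultimately have "emeasure (dirac_comb L) ({u. g u \<noteq> 0} - S) = 0"
    by (subst emeasure_dirac_comb_finite) auto
  then have "{u. g u \<noteq> 0} - S \<in> null_sets (dirac_comb L)"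
    using bad by (intro null_setsI) auto
  then have AE: "AE u in dirac_comb L. g u = (\<Sum>x\<in>S. indicator {x} u *\<^sub>R g x)"
  proof (rule AE_I')
    have on: "g u = (\<Sum>x\<in>S. indicator {x} u *\<^sub>R g x)" if "u \<in> S" for u
      using that S(1) by (subst sum.remove[of _ u]) (auto simp: indicator_def intro!: sum.neutral)
    have off: "(\<Sum>x\<in>S. indicator {x} u *\<^sub>R g x) = 0" if "u \<notin> S" for u
      using that by (intro sum.neutral) (auto simp: indicator_def)
    show "{u \<in> space (dirac_comb L). g u \<noteq> (\<Sum>x\<in>S. indicator {x} u *\<^sub>R g x)}
        \<subseteq> {u. g u \<noteq> 0} - S"
    proof
      fix u assume "u \<in> {u \<in> space (dirac_comb L). g u \<noteq> (\<Sum>x\<in>S. indicator {x} u *\<^sub>R g x)}"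
      then have ne: "g u \<noteq> (\<Sum>x\<in>S. indicator {x} u *\<^sub>R g x)" by simp
      then have "u \<notin> S" using on by blast
      with ne off show "u \<in> {u. g u \<noteq> 0} - S" by simp
    qed
  qed
  have "measure_convolution (dirac_comb L) \<phi> s
      = (\<integral>u. (\<Sum>x\<in>S. indicator {x} u *\<^sub>R g x) \<partial>dirac_comb L)"
    unfolding measure_convolution_def g_def[symmetric]
    using AE Sb by (intro integral_cong_AE borel_measurable_sum borel_measurable_scaleR
        borel_measurable_indicator borel_measurable_const) auto
  also have "\<dots> = (\<Sum>x\<in>S. \<integral>u. indicator {x} u *\<^sub>R g x \<partial>dirac_comb L)"
    using Sb em by (intro Bochner_Integration.integral_sum integrable_scaleR_left) 
       (auto simp: integrable_indicator_iff)
  also have "\<dots> = (\<Sum>x\<in>S. g x)"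
    using em Sb by (intro sum.cong) (auto simp: measure_def)
  finally show ?thesis by (simp add: g_def)
qed

text \<open>
  The comb only sees the trace of a set on \<open>L\<close>. The open set \<open>- (L - A)\<close> has the same trace as \<open>A\<close>,
  and finite subsets of \<open>L \<inter> U\<close> are compact sets exhausting the mass of \<open>U\<close>.
\<close>

lemma regular_dirac_comb:
  fixes L :: "'a::{topological_ab_group_add, t2_space} set"
  assumes ud: "uniformly_discrete L"
  shows "regular_borel_measure (dirac_comb L)"
  unfolding regular_borel_measure_def
proof (intro conjI allI impI ballI)
  fix K :: "'a set" assume "compact K"
  then show "emeasure (dirac_comb L) K < \<infinity>"
    using uniformly_discrete_finite_Int[OF ud]
    by (subst emeasure_dirac_comb_finite)
      (auto intro: borel_closed compact_imp_closed simp: less_top[symmetric])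
next
  fix A :: "'a set" assume A: "A \<in> sets borel"
  show "emeasure (dirac_comb L) A = (INF U\<in>{U. open U \<and> A \<subseteq> U}. emeasure (dirac_comb L) U)"
  proof (rule antisym)
    have "open (- (L - A))"
      using uniformly_discrete_subset_closed[OF ud, of "L - A"] by (simp only: closed_def Diff_subset)
    moreover from this have "emeasure (dirac_comb L) A = emeasure (dirac_comb L) (- (L - A))"
      using A by (intro emeasure_dirac_comb_cong) (auto intro: borel_open)
    ultimately show "(INF U\<in>{U. open U \<and> A \<subseteq> U}. emeasure (dirac_comb L) U)
        \<le> emeasure (dirac_comb L) A"
      by (intro INF_lower2[of "- (L - A)"]) auto
  qed (auto intro!: INF_greatest emeasure_mono)
next
  fix U :: "'a set" assume U: "open U"
  show "emeasure (dirac_comb L) U = (SUP K\<in>{K. compact K \<and> K \<subseteq> U}. emeasure (dirac_comb L) K)"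
  proof (rule antisym)
    have "(\<Sum>x\<in>F. indicator U x) \<le> (SUP K\<in>{K. compact K \<and> K \<subseteq> U}. emeasure (dirac_comb L) K)"
      if F: "finite F" "F \<subseteq> L" for F
    proof (rule SUP_upper2[of "F \<inter> U"])
      have "(\<Sum>x\<in>F. indicator U x) = (\<Sum>x\<in>F \<inter> U. 1 :: ennreal)"
        using F by (intro sum.mono_neutral_cong_right) auto
      also have "\<dots> = of_nat (card (F \<inter> U))" by simp
      also have "\<dots> = emeasure (dirac_comb L) (F \<inter> U)"
        using F by (subst emeasure_dirac_comb_finite)
          (auto intro!: borel_closed finite_imp_closed arg_cong[where f=card])
      finally show "(\<Sum>x\<in>F. indicator U x) \<le> emeasure (dirac_comb L) (F \<inter> U)" by simp
    qed (use F in \<open>auto intro: finite_imp_compact\<close>)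
    then show "emeasure (dirac_comb L) U
        \<le> (SUP K\<in>{K. compact K \<and> K \<subseteq> U}. emeasure (dirac_comb L) K)"
      using U by (subst emeasure_dirac_comb_SUP) (auto intro!: SUP_least)
    show "(SUP K\<in>{K. compact K \<and> K \<subseteq> U}. emeasure (dirac_comb L) K) \<le> emeasure (dirac_comb L) U"
      using U by (auto intro!: SUP_least emeasure_mono)
  qed
qed simp

lemma translation_bounded_dirac_comb:
  fixes L :: "'a::{topological_ab_group_add, t2_space} set"
  assumes lc: "locally_compact_space (euclidean :: 'a topology)" and ud: "uniformly_discrete L"
  shows "translation_bounded (dirac_comb L)"
proof -
  obtain V K :: "'a set" where V: "open V" "compact K" "0 \<in> V" "V \<subseteq> K"
    using locally_compact_zero_nbhd[OF lc] by blast
  have "closure V \<subseteq> K" using V by (intro closure_minimal compact_imp_closed)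
  then have "compact (closure V)"
    using V(2) closed_closure compact_Int_closed by (metis inf.absorb_iff2)
  obtain N where N: "\<And>t. finite (L \<inter> (+) t ` K)" "\<And>t. card (L \<inter> (+) t ` K) \<le> N"
    using uniformly_discrete_card_translate_bound[OF ud V(2)] by metis
  have "emeasure (dirac_comb L) ((+) t ` V) \<le> ennreal (real N)" for t
  proof -
    have "(+) t ` V = {x. x - t \<in> V}" by (auto simp: mem_translate_iff)
    then have "open ((+) t ` V)" using open_minus_const_vimage[OF V(1)] by simp
    moreover have sub: "L \<inter> (+) t ` V \<subseteq> L \<inter> (+) t ` K" using V by auto
    ultimately have "emeasure (dirac_comb L) ((+) t ` V) = of_nat (card (L \<inter> (+) t ` V))"
      using finite_subset[OF sub N(1)]
      by (intro emeasure_dirac_comb_finite) (auto intro: borel_open)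
    moreover have "card (L \<inter> (+) t ` V) \<le> N"
      using card_mono[OF N(1) sub] N(2) le_trans by blast
    ultimately show ?thesis by (simp add: ennreal_of_nat_eq_real_of_nat)
  qed
  then show ?thesis
    unfolding translation_bounded_def
    using V(1,3) \<open>compact (closure V)\<close> regular_dirac_comb[OF ud]
    by (intro conjI exI[of _ V] exI[of _ "real N"]) auto
qed

section \<open>Convolutions with the Dirac comb\<close>

lemma C_c_supportE:
  assumes "\<phi> \<in> C_c"
  obtains Q where "compact Q" "\<And>x. \<phi> x \<noteq> 0 \<Longrightarrow> x \<in> Q"
  using assms that[of "closure {x. \<phi> x \<noteq> 0}"] closure_subset by (fastforce simp: C_c_def)

text \<open>
  On a relatively compact neighbourhood of \<open>s0\<close> the convolution is a sum over one fixed finite set.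
\<close>

lemma continuous_measure_convolution_dirac_comb:
  fixes L :: "'a::{topological_ab_group_add, t2_space} set"
  assumes lc: "locally_compact_space (euclidean :: 'a topology)" and ud: "uniformly_discrete L"
    and \<phi>: "\<phi> \<in> C_c"
  shows "continuous_on UNIV (measure_convolution (dirac_comb L) \<phi>)"
proof -
  obtain Q where Q: "compact Q" "\<And>x. \<phi> x \<noteq> 0 \<Longrightarrow> x \<in> Q" using C_c_supportE[OF \<phi>] by metis
  have cont: "continuous_on UNIV \<phi>" using \<phi> by (simp add: C_c_def)
  obtain V K :: "'a set" where V: "open V" "compact K" "0 \<in> V" "V \<subseteq> K"
    using locally_compact_zero_nbhd[OF lc] by blast
  have "\<exists>N. open N \<and> s0 \<in> N \<and> continuous_on N (measure_convolution (dirac_comb L) \<phi>)" for s0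
  proof -
    let ?N = "{s. s - s0 \<in> V}"
    define S where "S = L \<inter> {a - q | a q. a \<in> (+) s0 ` K \<and> q \<in> Q}"
    have "finite S"
      unfolding S_def
      by (intro uniformly_discrete_finite_Int[OF ud] compact_set_minus compact_translate V Q)
    have "measure_convolution (dirac_comb L) \<phi> s = (\<Sum>x\<in>S. \<phi> (s - x))" if "s \<in> ?N" for s
    proof (rule measure_convolution_dirac_comb[OF cont \<open>finite S\<close>])
      fix x assume x: "x \<in> L" "\<phi> (s - x) \<noteq> 0"
      have "x = s - (s - x)" "s \<in> (+) s0 ` K" "s - x \<in> Q"
        using that V(4) Q(2) x(2) by (auto simp: mem_translate_iff)
      with x(1) show "x \<in> S" unfolding S_def by blast
    qed (simp add: S_def)
    moreover have "continuous_on ?N (\<lambda>s. \<Sum>x\<in>S. \<phi> (s - x))"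
      by (intro continuous_on_sum continuous_on_compose2[OF cont] continuous_intros) auto
    ultimately have "continuous_on ?N (measure_convolution (dirac_comb L) \<phi>)"
      by (subst continuous_on_cong[OF refl]) auto
    then show ?thesis using V open_minus_const_vimage[OF V(1)] by (intro exI[of _ ?N]) auto
  qed
  then show ?thesis
    by (metis continuous_on_eq_continuous_at continuous_at_imp_continuous_on)
qed

text \<open>
  The sum defining the convolution at \<open>s\<close> runs over points of \<open>L\<close> in the translate \<open>s - Q\<close> of a
  fixed compact set, and the number of those is bounded independently of \<open>s\<close>.
\<close>

lemma bounded_measure_convolution_dirac_comb:
  fixes L :: "'a::{topological_ab_group_add, t2_space} set"
  assumes ud: "uniformly_discrete L" and \<phi>: "\<phi> \<in> C_c"
  shows "bounded (range (measure_convolution (dirac_comb L) \<phi>))"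
proof -
  obtain Q where Q: "compact Q" "\<And>x. \<phi> x \<noteq> 0 \<Longrightarrow> x \<in> Q" using C_c_supportE[OF \<phi>] by metis
  have cont: "continuous_on UNIV \<phi>" using \<phi> by (simp add: C_c_def)
  have "compact (\<phi> ` Q)" 
    using cont Q(1) by (meson compact_continuous_image continuous_on_subset top_greatest)
  then obtain B0 where B0: "\<And>x. x \<in> Q \<Longrightarrow> cmod (\<phi> x) \<le> B0"
    using compact_imp_bounded[of "\<phi> ` Q"] by (auto simp: bounded_iff)
  define B where "B = max B0 0"
  have B: "B \<ge> 0" "cmod (\<phi> x) \<le> B" for x
    using B0[of x] Q(2)[of x] by (cases "\<phi> x = 0"; force simp: B_def)+
  have cM: "compact (uminus ` Q)"
    by (intro compact_continuous_image Q continuous_intros)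
  obtain N where N: "\<And>t. finite (L \<inter> (+) t ` uminus ` Q)" "\<And>t. card (L \<inter> (+) t ` uminus ` Q) \<le> N"
    using uniformly_discrete_card_translate_bound[OF ud cM] by metis
  have "cmod (measure_convolution (dirac_comb L) \<phi> s) \<le> real N * B" for s
  proof -
    have "measure_convolution (dirac_comb L) \<phi> s = (\<Sum>x\<in>L \<inter> (+) s ` uminus ` Q. \<phi> (s - x))"
    proof (rule measure_convolution_dirac_comb[OF cont N(1)])
      fix x assume "x \<in> L" "\<phi> (s - x) \<noteq> 0"
      moreover have "x - s = - (s - x)" by simp
      ultimately show "x \<in> L \<inter> (+) s ` uminus ` Q"
        using Q(2) by (metis IntI imageI mem_translate_iff)
    qed simp
    also have "cmod \<dots> \<le> real (card (L \<inter> (+) s ` uminus ` Q)) * B"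
      using B(2) by (intro sum_norm_bound) auto
    also have "\<dots> \<le> real N * B"
      using N(2) B(1) by (intro mult_right_mono) auto
    finally show ?thesis .
  qed
  then show ?thesis by (auto simp: bounded_iff)
qed

lemma finite_convolution_support:
  fixes L :: "'a::{topological_ab_group_add, t2_space} set"
  assumes ud: "uniformly_discrete L" and \<phi>: "\<phi> \<in> C_c"
  shows "finite {x \<in> L. \<phi> (s - x) \<noteq> 0}"
proof -
  obtain Q where Q: "compact Q" "\<And>x. \<phi> x \<noteq> 0 \<Longrightarrow> x \<in> Q" using C_c_supportE[OF \<phi>] by metis
  have "compact ((\<lambda>q. s - q) ` Q)"
    by (intro compact_continuous_image Q continuous_intros)
  from uniformly_discrete_finite_Int[OF ud this] show ?thesis
  proof (rule rev_finite_subset)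
    have "x = s - (s - x)" for x by simp
    then show "{x \<in> L. \<phi> (s - x) \<noteq> 0} \<subseteq> L \<inter> (\<lambda>q. s - q) ` Q"
      using Q(2) by blast
  qed
qed

lemma measure_convolution_dirac_comb_eq:
  fixes L :: "'a::{topological_ab_group_add, t2_space} set"
  assumes ud: "uniformly_discrete L" and \<phi>: "\<phi> \<in> C_c"
  shows "measure_convolution (dirac_comb L) \<phi> s = (\<Sum>x | x \<in> L \<and> \<phi> (s - x) \<noteq> 0. \<phi> (s - x))"
  using \<phi> by (intro measure_convolution_dirac_comb finite_convolution_support[OF ud \<phi>])
    (auto simp: C_c_def)

lemma periods_translate_iff:
  fixes L :: "'a::{topological_ab_group_add, t2_space} set"
  assumes "t \<in> periods L"
  shows "x - t \<in> L \<longleftrightarrow> x \<in> L"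
  using assms mem_translate_iff[of x t L] by (simp add: periods_def)

lemma measure_convolution_dirac_comb_period:
  fixes L :: "'a::{topological_ab_group_add, t2_space} set"
  assumes ud: "uniformly_discrete L" and \<phi>: "\<phi> \<in> C_c" and t: "t \<in> periods L"
  shows "measure_convolution (dirac_comb L) \<phi> (s - t) = measure_convolution (dirac_comb L) \<phi> s"
  unfolding measure_convolution_dirac_comb_eq[OF ud \<phi>]
proof (rule sum.reindex_bij_witness[of _ "\<lambda>x. x - t" "\<lambda>x. x + t"])
  fix x assume "x \<in> {x \<in> L. \<phi> (s - t - x) \<noteq> 0}"
  then show "x + t \<in> {x \<in> L. \<phi> (s - x) \<noteq> 0}" "\<phi> (s - (x + t)) = \<phi> (s - t - x)"
    using periods_translate_iff[OF t, of "x + t"] by (simp_all add: algebra_simps)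
next
  fix x assume "x \<in> {x \<in> L. \<phi> (s - x) \<noteq> 0}"
  then show "x - t \<in> {x \<in> L. \<phi> (s - t - x) \<noteq> 0}"
    using periods_translate_iff[OF t, of x] by (simp add: algebra_simps)
qed simp_all

section \<open>Periodicity and almost periodicity\<close>

lemma relatively_dense_mono:
  fixes A B :: "'a::{topological_ab_group_add, t2_space} set"
  assumes "relatively_dense A" "A \<subseteq> B"
  shows "relatively_dense B"
proof -
  obtain K where K: "compact K" "{a + k | a k. a \<in> A \<and> k \<in> K} = UNIV"
    using assms(1) unfolding relatively_dense_def by blast
  have "{a + k | a k. a \<in> A \<and> k \<in> K} \<subseteq> {a + k | a k. a \<in> B \<and> k \<in> K}"
    using assms(2) by blast
  with K(2) have "{a + k | a k. a \<in> B \<and> k \<in> K} = UNIV" by auto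
  with K(1) show ?thesis unfolding relatively_dense_def by blast
qed

lemma relatively_dense_perturb:
  fixes A B :: "'a::{topological_ab_group_add, t2_space} set"
  assumes A: "relatively_dense A" and "compact C"
    and near: "\<And>a. a \<in> A \<Longrightarrow> \<exists>b\<in>B. a - b \<in> C"
  shows "relatively_dense B"
proof -
  obtain K where K: "compact K" "{a + k | a k. a \<in> A \<and> k \<in> K} = UNIV"
    using A unfolding relatively_dense_def by blast
  have "g \<in> {b + k | b k. b \<in> B \<and> k \<in> {c + k | c k. c \<in> C \<and> k \<in> K}}" for g
  proof -
    have "g \<in> {a + k | a k. a \<in> A \<and> k \<in> K}" using K(2) by simp
    then obtain a k where ak: "a \<in> A" "k \<in> K" "g = a + k" by blast
    obtain b where b: "b \<in> B" "a - b \<in> C" using near[OF ak(1)] by blast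
    have "g = b + ((a - b) + k)" using ak(3) by simp
    with b ak(2) show ?thesis by blast
  qed
  then have "{b + k | b k. b \<in> B \<and> k \<in> {c + k | c k. c \<in> C \<and> k \<in> K}} = UNIV"
    by (rule UNIV_eq_I[symmetric])
  then show ?thesis
    unfolding relatively_dense_def
    by (intro exI[of _ "{c + k | c k. c \<in> C \<and> k \<in> K}"] conjI
        compact_set_plus[OF \<open>compact C\<close> K(1)])
qed

lemma strongly_almost_periodic_if_completely_periodic:
  fixes L :: "'a::{topological_ab_group_add, t2_space} set"
  assumes lc: "locally_compact_space (euclidean :: 'a topology)" and ud: "uniformly_discrete L"
    and per: "completely_periodic L"
  shows "strongly_almost_periodic (dirac_comb L)"
proof -
  have "relatively_dense {t. (SUP s. cmod (measure_convolution (dirac_comb L) \<phi> (s - t)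
        - measure_convolution (dirac_comb L) \<phi> s)) \<le> \<epsilon>}"
    if "\<phi> \<in> C_c" "\<epsilon> > 0" for \<phi> \<epsilon>
    using per that unfolding completely_periodic_def
    by (elim relatively_dense_mono) (auto simp: measure_convolution_dirac_comb_period[OF ud])
  then show ?thesis
    unfolding strongly_almost_periodic_def Bohr_almost_periodic_def
    using translation_bounded_dirac_comb[OF lc ud]
      continuous_measure_convolution_dirac_comb[OF lc ud]
      bounded_measure_convolution_dirac_comb[OF ud] by blast
qed

text \<open>
  The differences in \<open>K\<close> are the points of the patches \<open>(- x + L) \<inter> K\<close>; there are finitely many
  patches, each of them finite.
\<close>

lemma finite_local_complexity_finite_differences:
  fixes L :: "'a::{topological_ab_group_add, t2_space} set"
  assumes ud: "uniformly_discrete L" and flc: "finite_local_complexity L" and K: "compact K"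
  shows "finite {y - x | x y. x \<in> L \<and> y \<in> L \<and> y - x \<in> K}"
proof (rule finite_subset)
  show "{y - x | x y. x \<in> L \<and> y \<in> L \<and> y - x \<in> K} \<subseteq> \<Union>{(+) (- x) ` L \<inter> K | x. x \<in> L}"
  proof
    fix d assume "d \<in> {y - x | x y. x \<in> L \<and> y \<in> L \<and> y - x \<in> K}"
    then obtain x y where xy: "d = y - x" "x \<in> L" "y \<in> L" "y - x \<in> K" by blast
    then have "d \<in> (+) (- x) ` L \<inter> K" by (simp add: mem_translate_iff)
    with xy(2) show "d \<in> \<Union>{(+) (- x) ` L \<inter> K | x. x \<in> L}" by blast
  qed
  have "finite ((+) (- x) ` L \<inter> K)" for x
  proof -
    have "finite (L \<inter> (+) x ` K)"
      by (intro uniformly_discrete_finite_Int[OF ud] compact_translate K)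
    then have "finite ((+) (- x) ` (L \<inter> (+) x ` K))" by simp
    moreover have "(+) (- x) ` L \<inter> K \<subseteq> (+) (- x) ` (L \<inter> (+) x ` K)"
      by (auto simp: mem_translate_iff)
    ultimately show ?thesis by (rule rev_finite_subset)
  qed
  then show "finite (\<Union>{(+) (- x) ` L \<inter> K | x. x \<in> L})"
    using flc K unfolding finite_local_complexity_def by (intro finite_Union) auto
qed

text \<open>
  The step hypothesis says that \<open>u\<close> agrees on points of \<open>L\<close> whose difference lies in
  \<open>(W \<union> {0}) + K - K\<close>. By induction on \<open>d\<close> in the group generated by \<open>W\<close>, it agrees on \<open>x\<close> and \<open>x'\<close>
  whenever \<open>x' - x \<in> d + K - K\<close>: a path from \<open>x\<close> with displacement \<open>s - t\<close> is cut at the point \<open>x + k + s\<close>,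
  which is close to a point of \<open>L\<close> because \<open>L + K\<close> is everything.
\<close>

lemma constant_on_chained:
  fixes L :: "'a::ab_group_add set"
  assumes gen: "group_closure W = UNIV"
    and dense: "{x + k | x k. x \<in> L \<and> k \<in> K} = UNIV"
    and step: "\<And>x x' w k k'. x \<in> L \<Longrightarrow> x' \<in> L \<Longrightarrow> w \<in> insert 0 W \<Longrightarrow> k \<in> K \<Longrightarrow> k' \<in> K \<Longrightarrow>
      x' - x = w + k - k' \<Longrightarrow> u x = u x'"
    and x: "x \<in> L" "x' \<in> L"
  shows "u x = u x'"
proof -
  have *: "\<forall>x\<in>L. \<forall>x'\<in>L. \<forall>k\<in>K. \<forall>k'\<in>K. x' + k' = x + k + d \<longrightarrow> u x = u x'"
    if "d \<in> group_closure W" for d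
    using that
  proof (induction d rule: group_closure.induct)
    case (base w)
    show ?case
    proof (intro ballI impI)
      fix x x' k k' assume *: "x \<in> L" "x' \<in> L" "k \<in> K" "k' \<in> K" "x' + k' = x + k + w"
      from *(5) have "x' - x = w + k - k'" by (simp add: algebra_simps)
      with step[OF *(1,2) base *(3,4)] show "u x = u x'" .
    qed
  next
    case (diff s t)
    show ?case
    proof (intro ballI impI)
      fix x x' k k' assume *: "x \<in> L" "x' \<in> L" "k \<in> K" "k' \<in> K" "x' + k' = x + k + (s - t)"
      have "x + k + s \<in> {x + k | x k. x \<in> L \<and> k \<in> K}" using dense by simp
      then obtain y l where y: "y \<in> L" "l \<in> K" "y + l = x + k + s" by force
      have "u x = u y" using diff.IH(1) * y by blast
      moreover have "y + l = x' + k' + t" using * y by (simp add: algebra_simps)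
      then have "u x' = u y" using diff.IH(2) * y by blast
      ultimately show "u x = u x'" by simp
    qed
  qed
  obtain k where "k \<in> K" using dense by blast
  have "x' + k = x + k + (x' - x)" by simp
  then show ?thesis using *[of "x' - x"] gen x \<open>k \<in> K\<close> by blast
qed

text \<open>
  The hypothesis on \<open>x, x', y, y'\<close> is the rigidity supplied by finite local complexity: it makes the
  error \<open>x - t - f x\<close> of a matching \<open>f\<close> between \<open>L - t\<close> and \<open>L\<close> the same along every step of a chain,
  hence equal to a constant \<open>u\<close>, so that \<open>L - (t + u) \<subseteq> L\<close>. The opposite inclusion is rigidity once
  more, now with \<open>x' = x\<close>: the point of \<open>L\<close> matched to \<open>y + t\<close> must have error \<open>-u\<close>.
\<close>

lemma approximate_translate_near_period:
  fixes L :: "'a::{topological_ab_group_add, t2_space} set"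
  assumes gen: "group_closure W = UNIV"
    and dense: "{x + k | x k. x \<in> L \<and> k \<in> K} = UNIV"
    and sym: "\<And>u. u \<in> U \<Longrightarrow> - u \<in> U"
    and rigid: "\<And>x x' y y' w k k' u v. x \<in> L \<Longrightarrow> x' \<in> L \<Longrightarrow> y \<in> L \<Longrightarrow> y' \<in> L \<Longrightarrow>
      w \<in> insert 0 W \<Longrightarrow> k \<in> K \<Longrightarrow> k' \<in> K \<Longrightarrow> x' - x = w + k - k' \<Longrightarrow> u \<in> U \<Longrightarrow> v \<in> U \<Longrightarrow>
      (x' - x) - (y' - y) = u - v \<Longrightarrow> u = v"
    and to: "\<And>x. x \<in> L \<Longrightarrow> \<exists>y\<in>L. x - t - y \<in> U"
    and onto: "\<And>y. y \<in> L \<Longrightarrow> \<exists>x\<in>L. y + t - x \<in> U"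
  shows "\<exists>p\<in>periods L. t - p \<in> U"
proof -
  obtain f where f: "\<And>x. x \<in> L \<Longrightarrow> f x \<in> L \<and> x - t - f x \<in> U" using to by metis
  have const: "x - t - f x = x' - t - f x'" if "x \<in> L" "x' \<in> L" for x x'
  proof (rule constant_on_chained[OF gen dense _ that])
    fix x x' w k k'
    assume *: "x \<in> L" "x' \<in> L" "w \<in> insert 0 W" "k \<in> K" "k' \<in> K" "x' - x = w + k - k'"
    have "(x' - x) - (f x' - f x) = (x' - t - f x') - (x - t - f x)"
      by (simp add: algebra_simps)
    then show "x - t - f x = x' - t - f x'"
      using rigid[OF *(1,2) _ _ *(3-6)] f *(1,2) by metis
  qed
  obtain x0 k0 where x0: "x0 \<in> L" "k0 \<in> K" using dense by blast
  define u where "u = x0 - t - f x0"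
  have u: "u \<in> U" using f x0 by (simp add: u_def)
  have f_eq: "f x = x - (t + u)" if "x \<in> L" for x
    using const[OF that x0(1)] by (simp add: u_def algebra_simps)
  have sub: "x - (t + u) \<in> L" if "x \<in> L" for x using f[OF that] f_eq[OF that] by simp
  have sup: "y + (t + u) \<in> L" if y: "y \<in> L" for y
  proof -
    obtain x where x: "x \<in> L" "y + t - x \<in> U" using onto[OF y] by blast
    have "u = - (y + t - x)"
    proof (rule rigid[OF x(1) x(1) y sub[OF x(1)] _ x0(2) x0(2)])
      show "(x - x) - (x - (t + u) - y) = u - - (y + t - x)"
        by (simp add: algebra_simps)
    qed (use u sym[OF x(2)] in simp_all)
    then have "y + (t + u) = x" by (simp add: algebra_simps)
    then show ?thesis using x(1) by simp
  qed
  have "t + u \<in> periods L"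
    unfolding periods_def
  proof (intro CollectI set_eqI)
    fix x
    show "x \<in> (+) (t + u) ` L \<longleftrightarrow> x \<in> L"
      using sub[of x] sup[of "x - (t + u)"] by (auto simp: mem_translate_iff)
  qed
  moreover have "t - (t + u) \<in> U" using sym[OF u] by simp
  ultimately show ?thesis by blast
qed

text \<open>
  Both differences \<open>x' - x\<close> and \<open>y' - y\<close> lie in the finite set \<open>F\<close> of differences of \<open>L\<close> inside the
  compact set \<open>D - (C - C)\<close>. That set depends on \<open>C\<close> only, so \<open>U \<subseteq> C\<close> can be chosen afterwards
  such that \<open>U - U\<close> meets \<open>F - F\<close> in \<open>0\<close> alone.
\<close>

lemma rigid_nbhd_exists:
  fixes L :: "'a::{topological_ab_group_add, t2_space} set"
  assumes ud: "uniformly_discrete L" and flc: "finite_local_complexity L"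
    and D: "compact D" and V: "open V" "0 \<in> V" "V \<subseteq> C" "compact C"
  obtains U where "open U" "0 \<in> U" "U \<subseteq> V" "\<forall>u\<in>U. - u \<in> U"
    "\<forall>x\<in>L. \<forall>x'\<in>L. \<forall>y\<in>L. \<forall>y'\<in>L. \<forall>u\<in>U. \<forall>v\<in>U.
      x' - x \<in> D \<longrightarrow> (x' - x) - (y' - y) = u - v \<longrightarrow> u = v"
proof -
  define E where "E = {d - c | d c. d \<in> D \<and> c \<in> {a - b | a b. a \<in> C \<and> b \<in> C}}"
  define F where "F = {y - x | x y. x \<in> L \<and> y \<in> L \<and> y - x \<in> E}"
  have "compact E" unfolding E_def by (intro compact_set_minus D V)
  then have "finite F"
    unfolding F_def by (rule finite_local_complexity_finite_differences[OF ud flc])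
  define T where "T = - ((\<lambda>(a, b). a - b) ` (F \<times> F) - {0})"
  have "open T" "0 \<in> T"
    unfolding T_def using \<open>finite F\<close> by (intro open_Compl finite_imp_closed) auto
  then obtain U where U: "open U" "0 \<in> U" "U \<subseteq> V" "\<forall>u\<in>U. - u \<in> U"
      "\<forall>u\<in>U. \<forall>v\<in>U. u - v \<in> T"
    by (rule symmetric_nbhd_diff_in[OF _ _ V(1,2)])
  show thesis
  proof (rule that[OF U(1-4)], intro ballI impI)
    fix x x' y y' u v
    assume *: "x \<in> L" "x' \<in> L" "y \<in> L" "y' \<in> L" "u \<in> U" "v \<in> U" "x' - x \<in> D"
      "(x' - x) - (y' - y) = u - v"
    have inE: "(x' - x) - (a - b) \<in> E" if "a \<in> U" "b \<in> U" for a b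
      using *(7) that U(3) V(3) unfolding E_def by blast
    have "x' - x \<in> E" using inE[OF U(2) U(2)] by simp
    moreover have "y' - y = (x' - x) - (u - v)" using *(8) by (simp add: algebra_simps)
    then have "y' - y \<in> E" using inE[OF *(5,6)] by simp
    ultimately have "x' - x \<in> F" "y' - y \<in> F" using *(1-4) by (auto simp: F_def)
    then have "u - v \<in> (\<lambda>(a, b). a - b) ` (F \<times> F)"
      unfolding *(8)[symmetric] by force
    moreover have "u - v \<in> T" using U(5) *(5,6) by blast
    ultimately show "u = v" by (simp add: T_def)
  qed
qed

lemma completely_periodic_if_strongly_almost_periodic:
  fixes L :: "'a::{topological_ab_group_add, t2_space} set"
  assumes lc: "locally_compact_space (euclidean :: 'a topology)"
    and cg: "compactly_generated TYPE('a)"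
    and ud: "uniformly_discrete L" and rd: "relatively_dense L"
    and flc: "finite_local_complexity L"
    and sap: "strongly_almost_periodic (dirac_comb L)"
  shows "completely_periodic L"
proof -
  obtain W :: "'a set" where W: "compact W" "group_closure W = UNIV"
    using cg unfolding compactly_generated_def by blast
  obtain K where K: "compact K" "{x + k | x k. x \<in> L \<and> k \<in> K} = UNIV"
    using rd unfolding relatively_dense_def by blast
  obtain V C :: "'a set" where V: "open V" "compact C" "0 \<in> V" "V \<subseteq> C"
    using locally_compact_zero_nbhd[OF lc] by blast
  define D where "D = {a - k' | a k'. a \<in> {w + k | w k. w \<in> insert 0 W \<and> k \<in> K} \<and> k' \<in> K}"
  have "compact D" unfolding D_def by (intro compact_set_minus compact_set_plus compact_insert W K)
  then obtain U where U: "open U" "0 \<in> U" "U \<subseteq> V" "\<forall>u\<in>U. - u \<in> U"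
    and rigid: "\<forall>x\<in>L. \<forall>x'\<in>L. \<forall>y\<in>L. \<forall>y'\<in>L. \<forall>u\<in>U. \<forall>v\<in>U.
      x' - x \<in> D \<longrightarrow> (x' - x) - (y' - y) = u - v \<longrightarrow> u = v"
    by (rule rigid_nbhd_exists[OF ud flc _ V(1,3,4,2)])
  have "U \<subseteq> C" using U V by blast
  obtain \<phi> :: "'a \<Rightarrow> real" where \<phi>: "(\<lambda>x. complex_of_real (\<phi> x)) \<in> C_c" "\<phi> 0 = 1"
      "\<forall>x. 0 \<le> \<phi> x" "\<forall>x. \<phi> x \<noteq> 0 \<longrightarrow> x \<in> U"
    by (rule locally_compact_bump[OF lc U(1,2) \<open>U \<subseteq> C\<close> V(2)])
  define f where "f = measure_convolution (dirac_comb L) (\<lambda>x. complex_of_real (\<phi> x))"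
  have f_eq: "f s = complex_of_real (\<Sum>x | x \<in> L \<and> \<phi> (s - x) \<noteq> 0. \<phi> (s - x))" for s
    unfolding f_def measure_convolution_dirac_comb_eq[OF ud \<phi>(1)] by simp
  have f_large: "1 \<le> cmod (f x)" if "x \<in> L" for x
  proof -
    have "\<phi> (x - x) \<le> (\<Sum>y | y \<in> L \<and> \<phi> (x - y) \<noteq> 0. \<phi> (x - y))"
      using finite_convolution_support[OF ud \<phi>(1), of x] that \<phi>(2,3)
      by (intro member_le_sum) auto
    then show ?thesis unfolding f_eq norm_of_real using \<phi>(2) by simp
  qed
  have f_supp: "\<exists>x\<in>L. s - x \<in> U" if "f s \<noteq> 0" for s
  proof (rule ccontr)
    assume "\<not> ?thesis"
    then have "{x \<in> L. \<phi> (s - x) \<noteq> 0} = {}" using \<phi>(4) by blast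
    then have "f s = 0" unfolding f_eq by (simp only: sum.empty of_real_0)
    with that show False by simp
  qed
  have bap: "Bohr_almost_periodic f"
    using sap \<phi>(1) by (simp add: strongly_almost_periodic_def f_def)
  define A where "A = {t. (SUP s. cmod (f (s - t) - f s)) \<le> 1/2}"
  have "relatively_dense A"
    using bap half_gt_zero[OF zero_less_one] unfolding Bohr_almost_periodic_def A_def by blast
  moreover have "\<exists>p\<in>periods L. t - p \<in> C" if t: "t \<in> A" for t
  proof -
    obtain B where B: "\<And>s. cmod (f s) \<le> B"
      using bap by (auto simp: Bohr_almost_periodic_def bounded_iff)
    have "cmod (f (s - t) - f s) \<le> B + B" for s
      using B norm_triangle_ineq4 order_trans add_mono by metis
    then have "bdd_above (range (\<lambda>s. cmod (f (s - t) - f s)))" by (auto simp: bdd_above_def)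
    then have close: "cmod (f (s - t) - f s) \<le> 1/2" for s
      using t cSUP_upper[of s UNIV "\<lambda>s. cmod (f (s - t) - f s)"] by (auto simp: A_def)
    have "\<exists>p\<in>periods L. t - p \<in> U"
    proof (rule approximate_translate_near_period[OF W(2) K(2) bspec[OF U(4)]])
      fix x assume "x \<in> L"
      then have "f (x - t) \<noteq> 0" using close[of x] f_large[of x] by auto
      then show "\<exists>y\<in>L. x - t - y \<in> U" by (rule f_supp)
    next
      fix y assume "y \<in> L"
      then have "f (y + t) \<noteq> 0" using close[of "y + t"] f_large[of y] by auto
      then show "\<exists>x\<in>L. y + t - x \<in> U" by (rule f_supp)
    next
      fix x x' y y' w k k' u v
      assume *: "x \<in> L" "x' \<in> L" "y \<in> L" "y' \<in> L" "w \<in> insert 0 W" "k \<in> K" "k' \<in> K"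
        "x' - x = w + k - k'" "u \<in> U" "v \<in> U" "(x' - x) - (y' - y) = u - v"
      have "x' - x \<in> D" using *(5-8) unfolding D_def by blast
      with rigid *(1-4,9-11) show "u = v" by blast
    qed
    then show ?thesis using \<open>U \<subseteq> C\<close> by blast
  qed
  ultimately show ?thesis
    unfolding completely_periodic_def by (rule relatively_dense_perturb[OF _ V(2)])
qed

theorem corollary5p6:
  fixes L :: "'a::{topological_ab_group_add, t2_space} set"
  assumes "locally_compact_space (euclidean :: 'a topology)"
    and "compactly_generated TYPE('a)"
    and "Delone L"
    and "finite_local_complexity L"
  shows "completely_periodic L \<longleftrightarrow> strongly_almost_periodic (dirac_comb L)"
proof -
  have "uniformly_discrete L" "relatively_dense L" using assms(3) by (simp_all add: Delone_def)
  then show ?thesis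
    using strongly_almost_periodic_if_completely_periodic[OF assms(1)]
      completely_periodic_if_strongly_almost_periodic[OF assms(1,2) _ _ assms(4)]
    by iprover
qed

end
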